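(* Let $p_7(n)$ denote the number of partitions of $n$ into parts congruent to $\pm 2, \pm 6, \pm 7, \pm 8,\pm 9,\pm 10,\pm 12,\pm 13,\pm 17,\pm 21,\pm 22,\pm 23,\pm 24,\pm 28 \pmod{60}$, where the parts congruent to $\pm 10 \pmod{60}$ have two colors. Let $p_8(n)$ denote the number of partitions of $n$ into parts congruent to $\pm 1, \pm 3, \pm 4, \pm 10,\pm 11,\pm 12,\pm 14,\pm 16,\pm 18, \pm 19,\pm 24,\pm 26,\pm 27,\pm 29 \pmod{60}$, where the parts congruent to $\pm 10 \pmod{60}$ have two colors. Let $p_9(n)$ denote the number of partitions of $n$ into parts congruent to $\pm 1, \pm 4, \pm 5, \pm 6,\pm 11,\pm 12,\pm 14,\pm 16, \pm 18, \pm 19,\pm 25,\pm 26, \pm 29 \pmod{60}$, where the parts congruent to $\pm 12, \pm 18 \pmod{60}$ have two colors. Let $p_{10}(n)$ denote the number of partitions of $n$ into parts congruent to $\pm 2, \pm 5, \pm 6,\pm 7,\pm 8,\pm 13,\pm 17,\pm 18,\pm 22, \pm 23,\pm 24,\pm 25,\pm 28 \pmod{60}$, where the parts congruent to $\pm 6, \pm 24 \pmod{60}$ have two colors. Then for each positive integer $n>1$, \[ p_7(n)+p_8(n-1)=p_9(n)+p_{10}(n-2). \]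
   Context: A partition in which parts from certain residue classes "have two colors" means each such part size may appear in two distinguishable copies (colors), so the generating function for parts $\equiv r \pmod{s}$ with $k$ colors is $\prod_{m\ge0}(1-q^{sm+r})^{-k}$. Here $\pm r \pmod{60}$ means the classes $r$ and $60-r$ modulo $60$; parts are positive integers. By convention $p_i(0)=1$. *)

theory Defs
  imports "HOL-Library.Multiset" "HOL-Number_Theory.Cong"
begin

(* The size-m part comes in k m colors; a colored part is a pair (size, color),
   and a partition is a finite multiset of colored parts. The value k m = 0 forbids the size m. *)
definition colored_partitions :: "(nat \<Rightarrow> nat) \<Rightarrow> nat \<Rightarrow> (nat \<times> nat) multiset set" where
  "colored_partitions k n =
     {M. (\<forall>(m, c) \<in> set_mset M. 0 < m \<and> c < k m) \<and> (\<Sum>(m, c) \<in># M. m) = n}"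

definition num_colored_partitions :: "(nat \<Rightarrow> nat) \<Rightarrow> nat \<Rightarrow> nat" where
  "num_colored_partitions k n = card (colored_partitions k n)"

definition in_pm_classes :: "nat \<Rightarrow> int set \<Rightarrow> nat \<Rightarrow> bool" where
  "in_pm_classes s R m \<longleftrightarrow>
     (\<exists>r\<in>R. [int m = r] (mod int s) \<or> [int m = - r] (mod int s))"

(* Allowed residues R up to sign; those in D have two colors. *)
definition pm_colors :: "nat \<Rightarrow> int set \<Rightarrow> int set \<Rightarrow> nat \<Rightarrow> nat" where
  "pm_colors s R D m =
     (if in_pm_classes s R m then (if in_pm_classes s D m then 2 else 1) else 0)"

definition p7 :: "nat \<Rightarrow> nat" where
  "p7 = num_colored_partitions
     (pm_colors 60 {2, 6, 7, 8, 9, 10, 12, 13, 17, 21, 22, 23, 24, 28} {10})"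

definition p8 :: "nat \<Rightarrow> nat" where
  "p8 = num_colored_partitions
     (pm_colors 60 {1, 3, 4, 10, 11, 12, 14, 16, 18, 19, 24, 26, 27, 29} {10})"

definition p9 :: "nat \<Rightarrow> nat" where
  "p9 = num_colored_partitions
     (pm_colors 60 {1, 4, 5, 6, 11, 12, 14, 16, 18, 19, 25, 26, 29} {12, 18})"

definition p10 :: "nat \<Rightarrow> nat" where
  "p10 = num_colored_partitions
     (pm_colors 60 {2, 5, 6, 7, 8, 13, 17, 18, 22, 23, 24, 25, 28} {6, 24})"

(* The cardinality above is thus a genuine count (card is 0 on infinite sets). *)
lemma finite_colored_partitions: "finite (colored_partitions k n)"
proof (rule finite_subset)
  let ?A = "SIGMA m:{1..n}. {..<k m}"
  have fin: "finite ?A" by simp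
  show "finite (\<Union>i\<le>n. mset ` {xs. set xs \<subseteq> ?A \<and> length xs = i})"
    using finite_lists_length_eq[OF fin] by blast
  show "colored_partitions k n \<subseteq> (\<Union>i\<le>n. mset ` {xs. set xs \<subseteq> ?A \<and> length xs = i})"
  proof
    fix M assume "M \<in> colored_partitions k n"
    then have M: "\<And>m c. (m, c) \<in># M \<Longrightarrow> 0 < m \<and> c < k m"
      and s: "(\<Sum>(m, c) \<in># M. m) = n"
      by (auto simp: colored_partitions_def)
    have le: "m \<le> n" if "(m, c) \<in># M" for m c
      using multi_member_split[OF that] s by auto
    have "size N \<le> (\<Sum>(m, c) \<in># N. m)" if "\<And>m c. (m, c) \<in># N \<Longrightarrow> 0 < m"
      for N :: "(nat \<times> nat) multiset"
      using that
    proof (induction N)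
      case (add x N)
      have "size N \<le> (\<Sum>(m, c) \<in># N. m)" using add.prems by (intro add.IH) auto
      moreover have "0 < fst x" using add.prems[of "fst x" "snd x"] by simp
      ultimately show ?case by (cases x) auto
    qed simp
    from this[of M] have size: "size M \<le> n" using M s by auto
    obtain xs where xs: "mset xs = M" using ex_mset by blast
    have "set xs \<subseteq> ?A"
      using M le xs by (fastforce simp flip: set_mset_mset)
    then show "M \<in> (\<Union>i\<le>n. mset ` {xs. set xs \<subseteq> ?A \<and> length xs = i})"
      using xs size by auto
  qed
qed

end

theory Submission
  imports Defs "HOL-Analysis.Analysis"
begin

text \<open>
Write \<open>f\<^sub>s(r) = (-q\<^sup>r; q\<^sup>s)(-q\<^sup>s\<^sup>-\<^sup>r; q\<^sup>s)(q\<^sup>s; q\<^sup>s)\<close> and \<open>g\<^sub>s(r)\<close> for the same product with \<open>q\<^sup>r\<close>, \<open>q\<^sup>s\<^sup>-\<^sup>r\<close>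
in place of \<open>-q\<^sup>r\<close>, \<open>-q\<^sup>s\<^sup>-\<^sup>r\<close>. By the Jacobi triple product both are theta series, and splitting the
double series of a product according to the parity of the sum of the two indices gives
\<open>g\<^sub>1\<^sub>5(2) g\<^sub>1\<^sub>5(7) = f\<^sub>3\<^sub>0(9) f\<^sub>3\<^sub>0(10) - q\<^sup>2 f\<^sub>3\<^sub>0(24) f\<^sub>3\<^sub>0(25)\<close> and
\<open>g\<^sub>1\<^sub>5(1) g\<^sub>1\<^sub>5(4) = f\<^sub>3\<^sub>0(5) f\<^sub>3\<^sub>0(12) - q f\<^sub>3\<^sub>0(20) f\<^sub>3\<^sub>0(27)\<close>.
After multiplication by a suitable product the right-hand sides become \<open>F\<^sub>7 - q\<^sup>2 F\<^sub>1\<^sub>0\<close> and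
\<open>F\<^sub>9 - q F\<^sub>8\<close>, where \<open>F\<^sub>i\<close> is the generating function of \<open>p\<^sub>i\<close>, and the left-hand sides become equal.
\<close>

subsection \<open>The $q$-binomial theorem\<close>

text \<open>The finite q-shifted factorial \<open>(x; Q)_n\<close>.\<close>

definition qpoch :: "real \<Rightarrow> real \<Rightarrow> nat \<Rightarrow> real" where
  "qpoch x Q n = (\<Prod>k<n. 1 - x * Q ^ k)"

text \<open>The Gaussian binomial coefficient, given by its Pascal rule instead of a quotient, so
  that no value of \<open>Q\<close> has to be excluded.\<close>

fun qbinomial :: "real \<Rightarrow> nat \<Rightarrow> nat \<Rightarrow> real" where
  "qbinomial Q n 0 = 1"
| "qbinomial Q 0 (Suc k) = 0"
| "qbinomial Q (Suc n) (Suc k) = qbinomial Q n (Suc k) + Q ^ (n - k) * qbinomial Q n k"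

lemma qbinomial_eq_0: "n < k \<Longrightarrow> qbinomial Q n k = 0"
  by (induction Q n k rule: qbinomial.induct) auto

lemma qbinomial_self: "qbinomial Q n n = 1"
  by (induction n) (simp_all add: qbinomial_eq_0)

text \<open>Multiplication by the new factor \<open>1 + x * Q ^ n\<close> is the Pascal rule on
  coefficients: \<open>Suc i choose 2\<close> exceeds \<open>i choose 2\<close> by \<open>i\<close>,
  and \<open>Q ^ i * Q ^ (n - i) = Q ^ n\<close>.\<close>

theorem qbinomial_theorem:
  "(\<Prod>k<n. 1 + x * Q ^ k) = (\<Sum>i\<le>n. Q ^ (i choose 2) * qbinomial Q n i * x ^ i)"
proof (induction n)
  case (Suc n)
  let ?f = "\<lambda>i. Q ^ (i choose 2) * qbinomial Q n i * x ^ i"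
  have step: "Q ^ (Suc i choose 2) * qbinomial Q (Suc n) (Suc i) * x ^ Suc i =
      ?f (Suc i) + ?f i * (x * Q ^ n)" if "i \<le> n" for i
  proof -
    have "Suc i choose 2 = i + (i choose 2)"
      by (simp add: numeral_2_eq_2)
    moreover have "Q ^ n = Q ^ i * Q ^ (n - i)"
      using that by (simp flip: power_add)
    ultimately show ?thesis
      by (simp add: power_add algebra_simps)
  qed
  have "(\<Sum>i\<le>Suc n. Q ^ (i choose 2) * qbinomial Q (Suc n) i * x ^ i) =
      1 + (\<Sum>i\<le>n. Q ^ (Suc i choose 2) * qbinomial Q (Suc n) (Suc i) * x ^ Suc i)"
    by (subst sum.atMost_Suc_shift) (simp add: numeral_2_eq_2)
  also have "\<dots> = 1 + (\<Sum>i\<le>n. ?f (Suc i) + ?f i * (x * Q ^ n))"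
    using step by (intro arg_cong[where f = "\<lambda>t. 1 + t"] sum.cong) auto
  also have "\<dots> = (1 + (\<Sum>i\<le>n. ?f (Suc i))) + (\<Sum>i\<le>n. ?f i) * (x * Q ^ n)"
    by (simp add: sum.distrib sum_distrib_right)
  also have "1 + (\<Sum>i\<le>n. ?f (Suc i)) = (\<Sum>i\<le>Suc n. ?f i)"
    by (subst sum.atMost_Suc_shift) (simp add: numeral_2_eq_2)
  also have "\<dots> = (\<Sum>i\<le>n. ?f i)"
    by (simp add: qbinomial_eq_0)
  finally show ?case
    using Suc.IH by (simp add: algebra_simps)
qed (simp add: numeral_2_eq_2)

lemma qpoch_Suc: "qpoch x Q (Suc n) = qpoch x Q n * (1 - x * Q ^ n)"
  by (simp add: qpoch_def)

text \<open>The quotient formula, multiplied out so that vanishing factors do no harm.\<close>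

lemma qbinomial_qpoch:
  "k \<le> n \<Longrightarrow> qbinomial Q n k * (qpoch Q Q k * qpoch Q Q (n - k)) = qpoch Q Q n"
proof (induction Q n k rule: qbinomial.induct)
  case (3 Q n k)
  show ?case
  proof (cases "k = n")
    case True
    then show ?thesis
      by (simp add: qbinomial_self) (simp add: qpoch_def)
  next
    case False
    then have kn: "k < n" using 3 by simp
    define m where "m = n - Suc k"
    have nk: "n - k = Suc m" "n - Suc k = m" "n = Suc (m + k)" using kn by (auto simp: m_def)
    have a: "qbinomial Q n (Suc k) * (qpoch Q Q k * (1 - Q ^ Suc k) * qpoch Q Q m) = qpoch Q Q n"
      using 3(1) kn nk by (simp add: qpoch_Suc)
    have b: "qbinomial Q n k * (qpoch Q Q k * (qpoch Q Q m * (1 - Q ^ Suc m))) = qpoch Q Q n"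
      using 3(2) kn nk by (simp add: qpoch_Suc)
    \<comment> \<open>The two Pascal summands carry the weights \<open>1 - Q^(m+1)\<close> and
      \<open>Q^(m+1) * (1 - Q^(k+1))\<close>, whose sum telescopes to
      \<open>1 - Q^(m+k+2)\<close>.\<close>
    have "qbinomial Q (Suc n) (Suc k) * (qpoch Q Q (Suc k) * qpoch Q Q (Suc n - Suc k)) =
      (1 - Q ^ Suc m) * (qbinomial Q n (Suc k) * (qpoch Q Q k * (1 - Q ^ Suc k) * qpoch Q Q m)) +
      Q ^ Suc m * (1 - Q ^ Suc k) *
       (qbinomial Q n k * (qpoch Q Q k * (qpoch Q Q m * (1 - Q ^ Suc m))))"
      by (simp add: nk qpoch_Suc algebra_simps)
    also have "\<dots> = qpoch Q Q n * (1 - Q ^ Suc m * Q ^ Suc k)"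
      by (simp only: a b) (simp add: algebra_simps)
    also have "Q ^ Suc m * Q ^ Suc k = Q * Q ^ n"
      by (simp add: nk power_add)
    finally show ?thesis by (simp add: qpoch_Suc)
  qed
qed (auto simp: qpoch_def)

section \<open>The finite form of the Jacobi triple product\<close>

definition triangular :: "int \<Rightarrow> int" where
  "triangular j = j * (j - 1) div 2"

lemma two_triangular: "2 * triangular j = j * (j - 1)"
  unfolding triangular_def by (cases "even j") auto

lemma triangular_of_nat: "triangular (int i) = int (i choose 2)"
proof -
  have "2 * int (i choose 2) = int i * (int i - 1)"
    by (cases i) (auto simp: choose_two zdiv_int algebra_simps simp flip: two_triangular[of "int i"] triangular_def)
  then show ?thesis using two_triangular[of "int i"] by simp
qed

text \<open>The general term of the bilateral series in the Jacobi triple product, with exponent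
  \<open>j(j-1)/2\<close> on \<open>Q\<close>.\<close>

definition theta_term :: "real \<Rightarrow> real \<Rightarrow> int \<Rightarrow> real" where
  "theta_term z Q j = z powi j * Q powi triangular j"

text \<open>The q-binomial theorem for \<open>z Q\<^sup>-\<^sup>n\<close>, recentred at the middle coefficient.\<close>
lemma jacobi_triple_finite:
  assumes "z \<noteq> 0" "Q \<noteq> 0"
  shows "(\<Prod>k<n. (1 + z * Q ^ k) * (1 + Q / z * Q ^ k)) =
    (\<Sum>j\<in>{-int n..int n}. theta_term z Q j * qbinomial Q (2 * n) (nat (int n + j)))"
proof -
  \<comment> \<open>The product of the factors \<open>z / Q ^ Suc k\<close> that are pulled out of
    the lower half of the \<open>2 * n\<close> factors.\<close>
  define c where "c = z ^ n * Q powi (- triangular (int n + 1))"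
  have c0: "c \<noteq> 0" using assms by (simp add: c_def)
  have split: "(\<Prod>k<2*n. 1 + z / Q ^ n * Q ^ k) =
      (\<Prod>k<n. 1 + z / Q ^ n * Q ^ k) * (\<Prod>k<n. 1 + z * Q ^ k)"
  proof -
    have "(\<Prod>k<2*n. 1 + z / Q ^ n * Q ^ k) =
      (\<Prod>k<n. 1 + z / Q ^ n * Q ^ k) * (\<Prod>k=n..<2*n. 1 + z / Q ^ n * Q ^ k)"
      using prod.atLeastLessThan_concat[of 0 n "2*n" "\<lambda>k. 1 + z / Q ^ n * Q ^ k"]
      by (simp add: atLeast0LessThan)
    also have "(\<Prod>k=n..<2*n. 1 + z / Q ^ n * Q ^ k) = (\<Prod>k<n. 1 + z / Q ^ n * Q ^ (k + n))"
      using prod.shift_bounds_nat_ivl[of "\<lambda>k. 1 + z / Q ^ n * Q ^ k" 0 n n]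
      by (simp add: atLeast0LessThan mult_2)
    also have "\<dots> = (\<Prod>k<n. 1 + z * Q ^ k)"
      using assms by (intro prod.cong) (auto simp: power_add)
    finally show ?thesis .
  qed
  \<comment> \<open>Read backwards, the lower factors are \<open>1 + z / Q^(k+1)\<close>; extracting
    \<open>z / Q^(k+1)\<close> leaves \<open>1 + Q^(k+1) / z\<close>.\<close>
  have low: "(\<Prod>k<n. 1 + z / Q ^ n * Q ^ k) = c * (\<Prod>k<n. 1 + Q / z * Q ^ k)"
  proof -
    have "(\<Prod>k<n. 1 + z / Q ^ n * Q ^ k) = (\<Prod>k<n. 1 + z / Q ^ n * Q ^ (n - Suc k))"
      by (subst prod.nat_diff_reindex[symmetric]) auto
    also have "\<dots> = (\<Prod>k<n. z / Q ^ Suc k * (1 + Q / z * Q ^ k))"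
    proof (intro prod.cong refl)
      fix k assume "k \<in> {..<n}"
      then have "Q ^ n = Q ^ Suc k * Q ^ (n - Suc k)"
        by (subst power_add[symmetric]) auto
      then show "1 + z / Q ^ n * Q ^ (n - Suc k) = z / Q ^ Suc k * (1 + Q / z * Q ^ k)"
        using assms by (simp add: field_simps)
    qed
    also have "\<dots> = (\<Prod>k<n. z / Q ^ Suc k) * (\<Prod>k<n. 1 + Q / z * Q ^ k)"
      by (rule prod.distrib)
    also have "(\<Prod>k<n. z / Q ^ Suc k) = c"
      unfolding c_def
    proof (induction n)
      case (Suc n)
      have "- triangular (int (Suc n) + 1) = - triangular (int n + 1) - int (Suc n)"
        using two_triangular[of "int n + 1"] two_triangular[of "int (Suc n) + 1"]
        by (simp add: algebra_simps)
      then have "Q powi (- triangular (int (Suc n) + 1)) = Q powi (- triangular (int n + 1)) / Q ^ Suc n"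
        using assms by (metis power_int_diff power_int_of_nat)
      then show ?case using Suc by (simp add: field_simps)
    qed (simp add: triangular_def)
    finally show ?thesis .
  qed
  have "c * (\<Prod>k<n. (1 + z * Q ^ k) * (1 + Q / z * Q ^ k)) = (\<Prod>k<2*n. 1 + z / Q ^ n * Q ^ k)"
    unfolding split low prod.distrib by (simp only: mult_ac)
  also have "\<dots> = (\<Sum>i\<le>2*n. Q ^ (i choose 2) * qbinomial Q (2*n) i * (z / Q ^ n) ^ i)"
    by (rule qbinomial_theorem)
  also have "\<dots> = (\<Sum>j\<in>{-int n..int n}. c * (theta_term z Q j * qbinomial Q (2 * n) (nat (int n + j))))"
  proof (rule sum.reindex_bij_witness[of _ "\<lambda>j. nat (int n + j)" "\<lambda>i. int i - int n"])
    fix i assume "i \<in> {..2 * n}"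
    \<comment> \<open>Recentring the index: the linear term \<open>- n * i\<close> absorbs the
      denominator of \<open>(z / Q ^ n) ^ i\<close>, and the constant is the one in
      \<open>c\<close>.\<close>
    have "triangular (int i - int n) - triangular (int n + 1) = triangular (int i) - int n * int i"
      using two_triangular[of "int i - int n"] two_triangular[of "int n + 1"] two_triangular[of "int i"]
      by (simp add: algebra_simps)
    then have "Q powi triangular (int i - int n) * Q powi (- triangular (int n + 1)) =
        Q ^ (i choose 2) / Q ^ (n * i)"
      using assms triangular_of_nat[of i]
      by (simp flip: power_int_add power_int_diff power_int_of_nat)
    moreover have "z ^ n * z powi (int i - int n) = z ^ i"
      using assms by (simp add: power_int_diff)
    moreover have "c * theta_term z Q (int i - int n) = (z ^ n * z powi (int i - int n)) *
        (Q powi triangular (int i - int n) * Q powi (- triangular (int n + 1)))"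
      unfolding c_def theta_term_def by (simp only: mult_ac)
    ultimately have "c * theta_term z Q (int i - int n) = z ^ i * (Q ^ (i choose 2) / Q ^ (n * i))"
      by (simp only:)
    moreover have "nat (int n + (int i - int n)) = i" by simp
    ultimately show "c * (theta_term z Q (int i - int n) * qbinomial Q (2 * n) (nat (int n + (int i - int n)))) =
        Q ^ (i choose 2) * qbinomial Q (2*n) i * (z / Q ^ n) ^ i"
      unfolding mult.assoc[symmetric] by (simp only:) (simp add: power_divide power_mult)
  qed auto
  finally show ?thesis
    using c0 by (simp flip: sum_distrib_left)
qed

subsection \<open>Theta series\<close>

text \<open>Tannery's theorem, carried over to sums over the integers by enumerating them with
  \<open>int_decode\<close>. It lets the finite triple product pass to the limit.\<close>

lemma dominated_convergence_infsum:
  fixes a :: "nat \<Rightarrow> int \<Rightarrow> real"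
  assumes lim: "\<And>j. (\<lambda>n. a n j) \<longlonglongrightarrow> b j"
    and dom: "\<And>n j. \<bar>a n j\<bar> \<le> M j"
    and M: "M summable_on UNIV"
  shows "(\<lambda>n. infsum (a n) UNIV) \<longlonglongrightarrow> infsum b UNIV"
proof -
  have bij: "bij int_decode" by (rule bij_int_decode)
  have M0: "0 \<le> M j" for j using dom[of 0 j] by linarith
  have Ms: "summable (\<lambda>k. M (int_decode k))"
    using M bij by (intro summable_on_imp_summable) (simp add: summable_on_reindex_bij_betw)
  have domb: "\<bar>b j\<bar> \<le> M j" for j
    using tendsto_rabs[OF lim[of j]] dom by (intro LIMSEQ_le_const2) auto
  have *: "infsum c UNIV = (\<Sum>k. c (int_decode k))" if "\<And>j. \<bar>c j\<bar> \<le> M j" for c :: "int \<Rightarrow> real"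
  proof -
    have "c summable_on UNIV"
      by (rule abs_summable_summable, rule summable_on_comparison_test[OF M]) (use that in auto)
    then have "((\<lambda>k. c (int_decode k)) has_sum infsum c UNIV) UNIV"
      using has_sum_reindex_bij_betw[OF bij] by (metis has_sum_infsum)
    then show ?thesis
      by (metis has_sum_imp_sums sums_unique)
  qed
  have "(\<lambda>n. \<Sum>k. a n (int_decode k)) \<longlonglongrightarrow> (\<Sum>k. b (int_decode k))"
    using tannerys_theorem[of "\<lambda>k n. a n (int_decode k)" "\<lambda>k. b (int_decode k)" sequentially
        "\<lambda>k. M (int_decode k)"] lim dom Ms by (simp add: case_prod_unfold)
  then show ?thesis using *[OF dom] *[OF domb] by simp
qed

lemma summable_on_int_split:
  fixes f :: "int \<Rightarrow> real"
  assumes "(\<lambda>n. f (int n)) summable_on UNIV" "(\<lambda>n. f (- int n)) summable_on UNIV"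
  shows "f summable_on UNIV"
proof -
  have "f summable_on range int" "f summable_on range (\<lambda>n. - int n)"
    using assms by (subst summable_on_reindex; simp add: inj_on_def o_def)+
  moreover have "(UNIV :: int set) = range int \<union> range (\<lambda>n. - int n)"
    by (auto simp: image_iff) (metis int_cases2)
  ultimately show ?thesis by (metis summable_on_union)
qed

text \<open>Consecutive terms have ratio \<open>|z| * Q ^ n\<close>, which tends to 0.\<close>

lemma summable_power_choose_two:
  fixes z Q :: real
  assumes "0 < Q" "Q < 1"
  shows "summable (\<lambda>n. \<bar>z\<bar> ^ n * Q ^ (n choose 2))"
proof -
  have "(\<lambda>n. \<bar>z\<bar> * Q ^ n) \<longlonglongrightarrow> \<bar>z\<bar> * 0"
    using assms by (intro tendsto_mult tendsto_const LIMSEQ_power_zero) auto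
  then have "\<forall>\<^sub>F n in sequentially. \<bar>z\<bar> * Q ^ n < 1 / 2"
    by (rule order_tendstoD) simp
  then obtain N where N: "\<And>n. n \<ge> N \<Longrightarrow> \<bar>z\<bar> * Q ^ n < 1 / 2"
    by (auto simp: eventually_at_top_linorder)
  show ?thesis
  proof (rule summable_ratio_test[of "1/2" N])
    fix n assume "N \<le> n"
    then have "(\<bar>z\<bar> * Q ^ n) * (\<bar>z\<bar> ^ n * Q ^ (n choose 2)) \<le> 1/2 * (\<bar>z\<bar> ^ n * Q ^ (n choose 2))"
      using N[of n] assms by (intro mult_right_mono) auto
    moreover have "Suc n choose 2 = n + (n choose 2)" by (simp add: numeral_2_eq_2)
    ultimately show "norm (\<bar>z\<bar> ^ Suc n * Q ^ (Suc n choose 2)) \<le> 1/2 * norm (\<bar>z\<bar> ^ n * Q ^ (n choose 2))"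
      using assms by (simp add: power_add abs_mult power_abs algebra_simps)
  qed simp
qed

lemma theta_term_of_nat: "theta_term z Q (int n) = z ^ n * Q ^ (n choose 2)"
  by (simp add: theta_term_def triangular_of_nat)

text \<open>Reflection: the negative half of the series at \<open>z\<close> is a nonnegative half at
  \<open>Q / z\<close>, so one-sided convergence suffices.\<close>

lemma theta_term_uminus:
  assumes "z \<noteq> 0" "Q \<noteq> 0"
  shows "theta_term z Q (- j) = theta_term (Q / z) Q j"
proof -
  have "triangular (- j) = j + triangular j"
    using two_triangular[of "- j"] two_triangular[of j] by (simp add: algebra_simps)
  then show ?thesis
    using assms by (simp add: theta_term_def power_int_add power_int_minus power_int_divide_distrib field_simps)
qed

lemma abs_theta_term_summable:
  assumes "0 < Q" "Q < 1" "z \<noteq> 0"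
  shows "(\<lambda>j. \<bar>theta_term z Q j\<bar>) summable_on UNIV"
proof (rule summable_on_int_split)
  have *: "(\<lambda>n. \<bar>theta_term w Q (int n)\<bar>) summable_on UNIV" for w
    unfolding theta_term_of_nat
    using assms summable_power_choose_two[of Q w]
    by (intro summable_nonneg_imp_summable_on) (auto simp: abs_mult power_abs)
  show "(\<lambda>n. \<bar>theta_term z Q (int n)\<bar>) summable_on UNIV" by (rule *)
  show "(\<lambda>n. \<bar>theta_term z Q (- int n)\<bar>) summable_on UNIV"
    using * assms by (simp add: theta_term_uminus)
qed

section \<open>The Jacobi triple product\<close>

definition theta :: "real \<Rightarrow> real \<Rightarrow> real" where
  "theta z Q = infsum (theta_term z Q) UNIV"

text \<open>The limit of the finite form: for fixed \<open>j\<close> the central coefficients tend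
  to \<open>C / (C * C)\<close>, and \<open>1 / (C * C)\<close> bounds all of them. The limits of
  the three products are hypotheses, to be supplied later as products over residue classes.\<close>

theorem jacobi_triple_product:
  assumes Q: "0 < Q" "Q < 1" and z: "z \<noteq> 0"
    and A: "(\<lambda>n. \<Prod>k<n. 1 + z * Q ^ k) \<longlonglongrightarrow> A"
    and B: "(\<lambda>n. \<Prod>k<n. 1 + Q / z * Q ^ k) \<longlonglongrightarrow> B"
    and C: "qpoch Q Q \<longlonglongrightarrow> C" and C0: "C > 0"
  shows "theta z Q = A * B * C"
proof -
  \<comment> \<open>Padding with zeros turns the finite sums into sums over all integers, as
    dominated convergence requires.\<close>
  define a where "a n j = (if \<bar>j\<bar> \<le> int n then theta_term z Q j * qbinomial Q (2 * n) (nat (int n + j)) else 0)"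
    for n j
  have factor: "0 \<le> 1 - Q * Q ^ k" "1 - Q * Q ^ k \<le> 1" for k
    using Q power_le_one[of Q "Suc k"] by auto
  have pos: "0 \<le> qpoch Q Q n" for n
    unfolding qpoch_def using factor by (intro prod_nonneg) auto
  have dec: "decseq (qpoch Q Q)"
    using pos factor by (intro decseq_SucI) (simp add: qpoch_Suc mult_left_le)
  \<comment> \<open>The partial products decrease from 1 to \<open>C\<close>; these two bounds give
    the domination of the coefficients.\<close>
  have ge: "C \<le> qpoch Q Q n" for n
    using decseq_ge[OF dec C] .
  have le: "qpoch Q Q n \<le> 1" for n
    using decseqD[OF dec, of 0 n] by (simp add: qpoch_def)
  have qb: "qbinomial Q n k = qpoch Q Q n / (qpoch Q Q k * qpoch Q Q (n - k))" if "k \<le> n" for n k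
  proof -
    have "qpoch Q Q k * qpoch Q Q (n - k) \<noteq> 0"
      using ge[of k] ge[of "n - k"] C0 by auto
    then show ?thesis using qbinomial_qpoch[OF that, of Q] by (simp add: field_simps)
  qed
  have "(\<lambda>n. infsum (a n) UNIV) \<longlonglongrightarrow> infsum (\<lambda>j. theta_term z Q j * (C / (C * C))) UNIV"
  proof (rule dominated_convergence_infsum)
    show "(\<lambda>n. a n j) \<longlonglongrightarrow> theta_term z Q j * (C / (C * C))" for j
    proof -
      have l: "filterlim (\<lambda>n. nat (int n + i)) sequentially sequentially" for i
        unfolding filterlim_at_top
      proof
        fix Z
        show "\<forall>\<^sub>F n in sequentially. Z \<le> nat (int n + i)"
          using eventually_ge_at_top[of "Z + nat \<bar>i\<bar>"] by eventually_elim linarith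
      qed
      have l2: "filterlim (\<lambda>n. 2 * n) sequentially (sequentially :: nat filter)"
        by (rule filterlim_at_top_mono[OF filterlim_ident]) auto
      have "(\<lambda>n. theta_term z Q j * (qpoch Q Q (2 * n) /
          (qpoch Q Q (nat (int n + j)) * qpoch Q Q (nat (int n + (- j)))))) \<longlonglongrightarrow> theta_term z Q j * (C / (C * C))"
        using C0 by (intro tendsto_intros filterlim_compose[OF C l] filterlim_compose[OF C l2]) auto
      moreover have "\<forall>\<^sub>F n in sequentially. theta_term z Q j * (qpoch Q Q (2 * n) /
          (qpoch Q Q (nat (int n + j)) * qpoch Q Q (nat (int n + (- j))))) = a n j"
        using eventually_ge_at_top[of "nat \<bar>j\<bar>"]
      proof eventually_elim
        case (elim n)
        then have "2 * n - nat (int n + j) = nat (int n + (- j))" "nat (int n + j) \<le> 2 * n" "\<bar>j\<bar> \<le> int n"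
          by linarith+
        then show ?case by (simp add: a_def qb)
      qed
      ultimately show ?thesis by (rule Lim_transform_eventually)
    qed
    show "\<bar>a n j\<bar> \<le> \<bar>theta_term z Q j\<bar> * (1 / (C * C))" for n j
    proof (cases "\<bar>j\<bar> \<le> int n")
      case True
      let ?k = "nat (int n + j)"
      have k: "?k \<le> 2 * n" using True by linarith
      have "C * C \<le> qpoch Q Q ?k * qpoch Q Q (2 * n - ?k)"
        using ge C0 by (intro mult_mono) (auto intro: order.trans[of 0 C])
      then have "qbinomial Q (2 * n) ?k \<le> 1 / (C * C)"
        unfolding qb[OF k] using le C0 pos by (intro frac_le) auto
      moreover have "0 \<le> qbinomial Q (2 * n) ?k" using pos unfolding qb[OF k] by simp
      ultimately show ?thesis using True 
        by (simp add: a_def abs_mult del: times_divide_eq_right) (rule mult_left_mono; simp)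
    qed (use C0 in \<open>simp add: a_def\<close>)
    show "(\<lambda>j. \<bar>theta_term z Q j\<bar> * (1 / (C * C))) summable_on UNIV"
      using abs_theta_term_summable[OF Q z] by (intro summable_on_cmult_left)
  qed
  moreover have "infsum (a n) UNIV = (\<Prod>k<n. 1 + z * Q ^ k) * (\<Prod>k<n. 1 + Q / z * Q ^ k)" for n
  proof -
    have "infsum (a n) UNIV = infsum (a n) {- int n..int n}"
      by (rule infsum_cong_neutral) (auto simp: a_def)
    also have "\<dots> = (\<Sum>j\<in>{- int n..int n}. theta_term z Q j * qbinomial Q (2 * n) (nat (int n + j)))"
      by (auto simp: a_def intro!: sum.cong)
    finally show ?thesis
      using jacobi_triple_finite[of z Q n] z Q by (simp add: prod.distrib)
  qed
  ultimately have "(\<lambda>n. (\<Prod>k<n. 1 + z * Q ^ k) * (\<Prod>k<n. 1 + Q / z * Q ^ k)) \<longlonglongrightarrow> theta z Q * (C / (C * C))"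
    by (simp only: infsum_cmult_left' theta_def)
  moreover have "(\<lambda>n. (\<Prod>k<n. 1 + z * Q ^ k) * (\<Prod>k<n. 1 + Q / z * Q ^ k)) \<longlonglongrightarrow> A * B"
    by (intro tendsto_intros A B)
  ultimately have "theta z Q * (C / (C * C)) = A * B" by (rule LIMSEQ_unique)
  then show ?thesis using C0 by (simp add: field_simps)
qed

section \<open>Products of two theta series\<close>

text \<open>Index pairs with even sum are \<open>(s + t, s - t)\<close>, those with odd sum
  \<open>(s + t + 1, s - t)\<close>. In these coordinates the quadratic exponent has no mixed term,
  so each half factors again, with base \<open>Q\<^sup>2\<close>.\<close>

theorem theta_mult:
  assumes Q: "0 < Q" "Q < 1" and z: "a \<noteq> 0" "c \<noteq> 0"
  shows "theta a Q * theta c Q =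
    theta (a * c) (Q\<^sup>2) * theta (a * Q / c) (Q\<^sup>2) +
    a * theta (a * c * Q) (Q\<^sup>2) * theta (a * Q\<^sup>2 / c) (Q\<^sup>2)"
proof -
  \<comment> \<open>Absolute convergence of the double series is what permits its rearrangement by
    parity.\<close>
  have prod: "((\<lambda>(i, j). theta_term x P i * theta_term y P j) has_sum (theta x P * theta y P)) UNIV"
    if "0 < P" "P < 1" "x \<noteq> 0" "y \<noteq> 0" for x y P
  proof -
    have 1: "(\<lambda>j. norm (theta_term x P j)) summable_on UNIV" "(\<lambda>j. norm (theta_term y P j)) summable_on UNIV"
      using that abs_theta_term_summable by auto
    have "(\<lambda>(i, j). theta_term x P i * theta_term y P j) summable_on (UNIV \<times> UNIV)"
    proof (rule abs_summable_summable, rule summable_on_SigmaI)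
      show "((\<lambda>j. norm (case (i, j) of (i, j) \<Rightarrow> theta_term x P i * theta_term y P j)) has_sum
          (\<bar>theta_term x P i\<bar> * infsum (\<lambda>j. norm (theta_term y P j)) UNIV)) UNIV" for i
        using has_sum_cmult_right[OF has_sum_infsum[OF 1(2)], of "\<bar>theta_term x P i\<bar>"]
        by (simp add: abs_mult)
      show "(\<lambda>i. \<bar>theta_term x P i\<bar> * infsum (\<lambda>j. norm (theta_term y P j)) UNIV) summable_on UNIV"
        using summable_on_cmult_left[OF 1(1)] by simp
    qed auto
    moreover from infsum_Sigma'_banach[OF this]
    have "infsum (\<lambda>(i, j). theta_term x P i * theta_term y P j) UNIV = theta x P * theta y P"
      by (simp add: theta_def infsum_cmult_left' infsum_cmult_right')
    ultimately show ?thesis by (simp add: has_sum_iff)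
  qed
  have P: "0 < Q\<^sup>2" "Q\<^sup>2 < 1" using Q by (auto simp: power_less_one_iff)
  let ?F = "\<lambda>(m, n). theta_term a Q m * theta_term c Q n"
  let ?E = "{(m, n). even (m + n)} :: (int \<times> int) set"
  have sq: "Q\<^sup>2 powi k = Q powi (2 * k)" for k
    by (simp add: power_int_mult)
  have even: "(?F has_sum (theta (a * c) (Q\<^sup>2) * theta (a * Q / c) (Q\<^sup>2))) ?E"
  proof -
    have "((\<lambda>(s, t). theta_term (a * c) (Q\<^sup>2) s * theta_term (a * Q / c) (Q\<^sup>2) t) has_sum
        (theta (a * c) (Q\<^sup>2) * theta (a * Q / c) (Q\<^sup>2))) UNIV"
      using prod P Q z by simp
    moreover have "theta_term (a * c) (Q\<^sup>2) s * theta_term (a * Q / c) (Q\<^sup>2) t =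
        theta_term a Q (s + t) * theta_term c Q (s - t)" for s t
    proof -
      have "triangular (s + t) + triangular (s - t) = 2 * triangular s + 2 * triangular t + t"
        using two_triangular[of "s + t"] two_triangular[of "s - t"] two_triangular[of s] two_triangular[of t]
        by (simp add: algebra_simps)
      then have "Q powi triangular (s + t) * Q powi triangular (s - t) = Q powi (2 * triangular s) * Q powi (2 * triangular t) * Q powi t"
        using Q by (simp flip: power_int_add)
      moreover have "theta_term (a * c) (Q\<^sup>2) s = a powi s * c powi s * Q powi (2 * triangular s)"
        by (simp add: theta_term_def sq power_int_mult_distrib)
      moreover have "theta_term (a * Q / c) (Q\<^sup>2) t = a powi t * Q powi t / c powi t * Q powi (2 * triangular t)"
        by (simp add: theta_term_def sq power_int_mult_distrib power_int_divide_distrib)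
      moreover have "theta_term a Q (s + t) * theta_term c Q (s - t) =
          a powi s * a powi t * (c powi s / c powi t) * (Q powi triangular (s + t) * Q powi triangular (s - t))"
        using z by (simp add: theta_term_def power_int_add power_int_diff)
      ultimately show ?thesis by simp
    qed
    moreover have "(m + n) div 2 + (m - n) div 2 = m" "(m + n) div 2 - (m - n) div 2 = n"
      if "even (m + n)" for m n :: int
      using that by presburger+
    ultimately show ?thesis
      by (subst has_sum_reindex_bij_witness[where S = ?E and T = UNIV and
            j = "\<lambda>(m, n). ((m + n) div 2, (m - n) div 2)" and i = "\<lambda>(s, t). (s + t, s - t)"])
        (simp_all add: case_prod_unfold split: prod.splits)
  qed
  have odd: "(?F has_sum (a * (theta (a * c * Q) (Q\<^sup>2) * theta (a * Q\<^sup>2 / c) (Q\<^sup>2)))) (- ?E)"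
  proof -
    have "((\<lambda>(s, t). a * (theta_term (a * c * Q) (Q\<^sup>2) s * theta_term (a * Q\<^sup>2 / c) (Q\<^sup>2) t)) has_sum
        (a * (theta (a * c * Q) (Q\<^sup>2) * theta (a * Q\<^sup>2 / c) (Q\<^sup>2)))) UNIV"
      using has_sum_cmult_right[OF prod[of "Q\<^sup>2" "a * c * Q" "a * Q\<^sup>2 / c"], of a] P Q z
      by (simp add: case_prod_unfold)
    moreover have "a * (theta_term (a * c * Q) (Q\<^sup>2) s * theta_term (a * Q\<^sup>2 / c) (Q\<^sup>2) t) =
        theta_term a Q (s + t + 1) * theta_term c Q (s - t)" for s t
    proof -
      \<comment> \<open>The extra unit in the first index produces the prefactor \<open>a\<close>
        and the additional powers \<open>Q^s\<close> and \<open>Q^(2t)\<close>, hence the shifted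
        arguments.\<close>
      have "triangular (s + t + 1) + triangular (s - t) = 2 * triangular s + s + 2 * triangular t + 2 * t"
        using two_triangular[of "s + t + 1"] two_triangular[of "s - t"] two_triangular[of s] two_triangular[of t]
        by (simp add: algebra_simps)
      then have "Q powi triangular (s + t + 1) * Q powi triangular (s - t) =
          Q powi (2 * triangular s) * Q powi s * Q powi (2 * triangular t) * Q powi (2 * t)"
        using Q by (simp flip: power_int_add)
      moreover have "theta_term (a * c * Q) (Q\<^sup>2) s = a powi s * c powi s * Q powi s * Q powi (2 * triangular s)"
        by (simp add: theta_term_def sq power_int_mult_distrib)
      moreover have "theta_term (a * Q\<^sup>2 / c) (Q\<^sup>2) t = a powi t * Q powi (2 * t) / c powi t * Q powi (2 * triangular t)"
        by (simp add: theta_term_def sq power_int_mult_distrib power_int_divide_distrib)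
      moreover have "theta_term a Q (s + t + 1) * theta_term c Q (s - t) =
          a powi s * a powi t * a * (c powi s / c powi t) * (Q powi triangular (s + t + 1) * Q powi triangular (s - t))"
        using z by (simp add: theta_term_def power_int_add power_int_diff)
      ultimately show ?thesis by simp
    qed
    moreover have "(m + n - 1) div 2 + (m - n - 1) div 2 + 1 = m" "(m + n - 1) div 2 - (m - n - 1) div 2 = n"
      if "odd (m + n)" for m n :: int
      using that by presburger+
    ultimately show ?thesis
      by (subst has_sum_reindex_bij_witness[where S = "- ?E" and T = UNIV and
            j = "\<lambda>(m, n). ((m + n - 1) div 2, (m - n - 1) div 2)" and i = "\<lambda>(s, t). (s + t + 1, s - t)"])
        (simp_all add: case_prod_unfold split: prod.splits)
  qed
  have "(?F has_sum (theta (a * c) (Q\<^sup>2) * theta (a * Q / c) (Q\<^sup>2) +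
     a * (theta (a * c * Q) (Q\<^sup>2) * theta (a * Q\<^sup>2 / c) (Q\<^sup>2)))) (?E \<union> - ?E)"
    by (rule has_sum_Un_disjoint[OF even odd]) auto
  then have "(?F has_sum (theta (a * c) (Q\<^sup>2) * theta (a * Q / c) (Q\<^sup>2) +
     a * (theta (a * c * Q) (Q\<^sup>2) * theta (a * Q\<^sup>2 / c) (Q\<^sup>2)))) UNIV"
    by (simp add: Un_def)
  from has_sum_unique[OF prod[OF Q z] this] show ?thesis by (simp add: mult.assoc)
qed

subsection \<open>Products over residue classes\<close>

text \<open>The infinite product of \<open>(1 - q^m)^(k m)\<close> over \<open>m >= 1\<close>,
  written through logarithms: multiplying and dividing products becomes adding and subtracting
  exponent functions.\<close>

definition eprod :: "real \<Rightarrow> (nat \<Rightarrow> real) \<Rightarrow> real" where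
  "eprod q k = exp (\<Sum>m. k (Suc m) * ln (1 - q ^ Suc m))"

text \<open>From \<open>ln y <= y - 1\<close> at \<open>y = 1 / (1 - x)\<close>, with
  \<open>x = q^(m+1) <= q\<close> in the denominator. The geometric bound makes \<open>eprod\<close>
  converge for bounded exponents.\<close>

lemma abs_ln_one_minus_power_le:
  fixes q :: real
  assumes "0 < q" "q < 1"
  shows "\<bar>ln (1 - q ^ Suc m)\<bar> \<le> q ^ Suc m / (1 - q)"
proof -
  have x: "0 < q ^ Suc m" "q ^ Suc m \<le> q" "q ^ Suc m < 1"
    using assms power_decreasing[of 1 "Suc m" q] power_Suc_less_one[of q m] by auto
  have "- ln (1 - q ^ Suc m) = ln (inverse (1 - q ^ Suc m))"
    using x by (simp add: ln_inverse del: power_Suc)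
  also have "\<dots> \<le> inverse (1 - q ^ Suc m) - 1"
    using x by (intro ln_le_minus_one) (simp del: power_Suc)
  also have "\<dots> = q ^ Suc m / (1 - q ^ Suc m)"
    using x by (simp add: field_simps del: power_Suc)
  also have "\<dots> \<le> q ^ Suc m / (1 - q)"
    using x assms by (intro divide_left_mono mult_pos_pos) (simp_all del: power_Suc)
  finally show ?thesis using x by (simp del: power_Suc)
qed

lemma eprod_summable:
  fixes k :: "nat \<Rightarrow> real"
  assumes "0 < q" "q < 1" "bounded (range k)"
  shows "summable (\<lambda>m. k (Suc m) * ln (1 - q ^ Suc m))"
proof -
  obtain K where K: "\<And>m. \<bar>k m\<bar> \<le> K"
    using assms(3) by (auto simp: bounded_iff)
  show ?thesis
  proof (rule summable_comparison_test')
    show "summable (\<lambda>m. K * (q ^ Suc m / (1 - q)))"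
      using assms by (intro summable_mult summable_divide) (simp add: summable_mult)
    show "norm (k (Suc m) * ln (1 - q ^ Suc m)) \<le> K * (q ^ Suc m / (1 - q))" for m
      using K[of "Suc m"] abs_ln_one_minus_power_le[OF assms(1,2), of m]
      by (simp only: real_norm_def abs_mult) (intro mult_mono; linarith)
  qed
qed

lemma eprod_pos: "0 < eprod q k"
  by (simp add: eprod_def)

lemma eprod_add:
  assumes "0 < q" "q < 1" "bounded (range k)" "bounded (range l)"
  shows "eprod q (\<lambda>m. k m + l m) = eprod q k * eprod q l"
  using suminf_add[OF eprod_summable[OF assms(1-3)] eprod_summable[OF assms(1,2,4)]]
  by (simp only: eprod_def distrib_right mult_exp_exp)

lemma eprod_diff:
  assumes "0 < q" "q < 1" "bounded (range k)" "bounded (range l)"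
  shows "eprod q (\<lambda>m. k m - l m) = eprod q k / eprod q l"
  using suminf_diff[OF eprod_summable[OF assms(1-3)] eprod_summable[OF assms(1,2,4)]]
  by (simp only: eprod_def left_diff_distrib exp_diff[symmetric])

lemma eprod_tendsto:
  assumes "0 < q" "q < 1" "bounded (range k)"
  shows "(\<lambda>N. exp (\<Sum>m<N. k (Suc m) * ln (1 - q ^ Suc m))) \<longlonglongrightarrow> eprod q k"
  unfolding eprod_def using summable_LIMSEQ[OF eprod_summable[OF assms]] by (rule tendsto_exp)

text \<open>Reducing \<open>r\<close> as well lets \<open>r = s\<close> stand for the multiples of
  \<open>s\<close>.\<close>

definition residue_class :: "nat \<Rightarrow> nat \<Rightarrow> nat \<Rightarrow> real" where
  "residue_class s r m = of_bool (m mod s = r mod s)"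

lemma bounded_residue_class: "bounded (range (residue_class s r))"
  by (rule boundedI[of _ 1]) (auto simp: residue_class_def)

text \<open>For \<open>0 < r <= s\<close> the positive members of the class are exactly
  \<open>r + s * k\<close>, so the full sum of logarithms is a reindexed sum over
  \<open>k\<close>.\<close>

lemma qpoch_tendsto:
  assumes q: "0 < q" "q < 1" and r: "0 < r" "r \<le> s"
  shows "qpoch (q ^ r) (q ^ s) \<longlonglongrightarrow> eprod q (residue_class s r)"
proof -
  let ?f = "\<lambda>m. residue_class s r (Suc m) * ln (1 - q ^ Suc m)"
  \<comment> \<open>Index \<open>m\<close> of the sum stands for the exponent \<open>m + 1\<close>,
    so \<open>r + s * k\<close> sits one place lower.\<close>
  let ?g = "\<lambda>k. r - 1 + s * k"
  have "strict_mono ?g"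
  proof (rule strict_monoI)
    fix i j :: nat assume "i < j"
    then have "s * i < s * j" using r by simp
    then show "?g i < ?g j" using r by linarith
  qed
  moreover have "?f m = 0" if "m \<notin> range ?g" for m
  proof (rule ccontr)
    assume "?f m \<noteq> 0"
    then have m: "Suc m mod s = r mod s" by (auto simp: residue_class_def split: if_splits)
    have "r \<le> Suc m"
    proof (cases "r = s")
      case True
      then have "s dvd Suc m" using m by auto
      then show ?thesis using True by (metis dvd_imp_le zero_less_Suc)
    next
      case False
      then show ?thesis using m r by (metis mod_less mod_less_eq_dividend nat_less_le order_le_less)
    qed
    moreover from this m obtain k where "Suc m - r = s * k"
      by (metis mod_eq_dvd_iff_nat dvdE)
    ultimately have "m = ?g k" using r by linarith
    then show False using that by blast
  qed
  ultimately have "(\<lambda>k. ?f (?g k)) sums suminf ?f"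
    using sums_mono_reindex[of ?g ?f] eprod_summable[OF q bounded_residue_class, THEN summable_sums] by blast
  moreover have "?f (?g k) = ln (1 - q ^ r * (q ^ s) ^ k)" for k
  proof -
    have "Suc (?g k) = r + s * k" using r by simp
    then show ?thesis by (simp add: residue_class_def power_add power_mult)
  qed
  ultimately have "(\<lambda>k. ln (1 - q ^ r * (q ^ s) ^ k)) sums suminf ?f" by simp
  then have "(\<lambda>n. exp (\<Sum>k<n. ln (1 - q ^ r * (q ^ s) ^ k))) \<longlonglongrightarrow> eprod q (residue_class s r)"
    unfolding sums_def eprod_def by (rule tendsto_exp)
  moreover have "exp (\<Sum>k<n. ln (1 - q ^ r * (q ^ s) ^ k)) = qpoch (q ^ r) (q ^ s) n" for n
  proof -
    have "q ^ r * (q ^ s) ^ k < 1" for k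
      using q r power_Suc_less_one[of q "r + s * k - 1"] by (simp flip: power_add power_mult)
    then show ?thesis by (simp add: exp_sum qpoch_def)
  qed
  ultimately show ?thesis by simp
qed

text \<open>Each factor \<open>1 + x\<close> is \<open>(1 - x^2) / (1 - x)\<close>; squaring doubles
  both residue and modulus.\<close>

lemma qpoch_uminus_tendsto:
  assumes q: "0 < q" "q < 1" and r: "0 < r" "r \<le> s"
  shows "(\<lambda>n. \<Prod>k<n. 1 + q ^ r * (q ^ s) ^ k) \<longlonglongrightarrow>
    eprod q (\<lambda>m. residue_class (2 * s) (2 * r) m - residue_class s r m)"
proof -
  have less: "q ^ r * (q ^ s) ^ k < 1" for k
    using q r power_Suc_less_one[of q "r + s * k - 1"] by (simp flip: power_add power_mult)
  have "(\<Prod>k<n. 1 + q ^ r * (q ^ s) ^ k) = qpoch (q ^ (2 * r)) (q ^ (2 * s)) n / qpoch (q ^ r) (q ^ s) n" for n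
    unfolding qpoch_def prod_dividef[symmetric]
  proof (rule prod.cong[OF refl])
    fix k
    have "1 - q ^ (2 * r) * (q ^ (2 * s)) ^ k = (1 + q ^ r * (q ^ s) ^ k) * (1 - q ^ r * (q ^ s) ^ k)"
      by (simp add: power_mult power2_eq_square power_mult_distrib algebra_simps)
    then show "1 + q ^ r * (q ^ s) ^ k =
        (1 - q ^ (2 * r) * (q ^ (2 * s)) ^ k) / (1 - q ^ r * (q ^ s) ^ k)"
      using less[of k] by simp
  qed
  then show ?thesis
    using tendsto_divide[OF qpoch_tendsto[OF q, of "2 * r" "2 * s"] qpoch_tendsto[OF q r]] r
      eprod_pos[of q "residue_class s r"]
    by (simp add: eprod_diff q bounded_residue_class)
qed

text \<open>The exponents of \<open>g_s(r)\<close>. Integer values keep the later identities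
  decidable by evaluation; adding indicators counts coinciding classes with multiplicity.\<close>

definition theta_minus_exps :: "nat \<Rightarrow> nat \<Rightarrow> nat \<Rightarrow> int" where
  "theta_minus_exps s r m =
     of_bool (m mod s = r mod s) + of_bool (m mod s = (s - r) mod s) + of_bool (m mod s = s mod s)"

text \<open>The factor \<open>1 + x\<close> is read as \<open>(1 - x\<^sup>2) / (1 - x)\<close>.\<close>
definition theta_plus_exps :: "nat \<Rightarrow> nat \<Rightarrow> nat \<Rightarrow> int" where
  "theta_plus_exps s r m =
     of_bool (m mod (2 * s) = (2 * r) mod (2 * s)) - of_bool (m mod s = r mod s) +
     (of_bool (m mod (2 * s) = (2 * (s - r)) mod (2 * s)) - of_bool (m mod s = (s - r) mod s)) +
     of_bool (m mod s = s mod s)"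

lemma theta_minus_exps_residue_class:
  "(\<lambda>m. real_of_int (theta_minus_exps s r m)) =
    (\<lambda>m. residue_class s r m + residue_class s (s - r) m + residue_class s s m)"
  by (simp add: fun_eq_iff theta_minus_exps_def residue_class_def)

lemma theta_plus_exps_residue_class:
  "(\<lambda>m. real_of_int (theta_plus_exps s r m)) =
    (\<lambda>m. residue_class (2 * s) (2 * r) m - residue_class s r m +
      (residue_class (2 * s) (2 * (s - r)) m - residue_class s (s - r) m) + residue_class s s m)"
  by (simp add: fun_eq_iff theta_plus_exps_def residue_class_def)

lemma bounded_theta_exps:
  "bounded (range (\<lambda>m. real_of_int (theta_minus_exps s r m)))"
  "bounded (range (\<lambda>m. real_of_int (theta_plus_exps s r m)))"
  unfolding theta_minus_exps_residue_class theta_plus_exps_residue_class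
  by (intro bounded_plus_comp bounded_minus_comp bounded_residue_class)+

text \<open>Periodicity, which reduces identities between exponents to finitely many
  residues.\<close>

lemma theta_exps_mod:
  "s dvd t \<Longrightarrow> theta_minus_exps s r (m mod t) = theta_minus_exps s r m"
  "2 * s dvd t \<Longrightarrow> theta_plus_exps s r (m mod t) = theta_plus_exps s r m"
  using dvd_mult_right[of 2 s t]
  by (simp_all add: theta_minus_exps_def theta_plus_exps_def mod_mod_cancel)

text \<open>The triple product at \<open>z = - q^r\<close>, where \<open>Q / z = - q^(s-r)\<close>:
  the three products run over the classes of \<open>r\<close>, \<open>s - r\<close> and
  \<open>s\<close>.\<close>

lemma theta_uminus_power:
  assumes q: "0 < q" "q < 1" and r: "0 < r" "r < s"
  shows "theta (- (q ^ r)) (q ^ s) =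
    eprod q (\<lambda>m. real_of_int (theta_minus_exps s r m))"
proof -
  have Q: "0 < q ^ s" "q ^ s < 1" using q r by (auto simp: power_less_one_iff)
  have "q ^ s = q ^ r * q ^ (s - r)" using r by (simp flip: power_add)
  then have d: "q ^ s / - (q ^ r) = - (q ^ (s - r))" using q by simp
  have "theta (- (q ^ r)) (q ^ s) = eprod q (residue_class s r) *
      eprod q (residue_class s (s - r)) * eprod q (residue_class s s)"
    using qpoch_tendsto[OF q, of r s] qpoch_tendsto[OF q, of "s - r" s] qpoch_tendsto[OF q, of s s] q r
    by (intro jacobi_triple_product[OF Q] eprod_pos)
      (auto simp: d qpoch_def[abs_def] simp del: divide_minus_right)
  then show ?thesis
    by (simp add: theta_minus_exps_residue_class eprod_add q bounded_residue_class bounded_plus_comp)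
qed

lemma theta_power:
  assumes q: "0 < q" "q < 1" and r: "0 < r" "r < s"
  shows "theta (q ^ r) (q ^ s) =
    eprod q (\<lambda>m. real_of_int (theta_plus_exps s r m))"
proof -
  have Q: "0 < q ^ s" "q ^ s < 1" using q r by (auto simp: power_less_one_iff)
  have "q ^ s = q ^ r * q ^ (s - r)" using r by (simp flip: power_add)
  then have d: "q ^ s / (q ^ r) = q ^ (s - r)" using q by simp
  have "theta (q ^ r) (q ^ s) = eprod q (\<lambda>m. residue_class (2 * s) (2 * r) m - residue_class s r m) *
      eprod q (\<lambda>m. residue_class (2 * s) (2 * (s - r)) m - residue_class s (s - r) m) *
      eprod q (residue_class s s)"
    using qpoch_uminus_tendsto[OF q, of r s] qpoch_uminus_tendsto[OF q, of "s - r" s]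
      qpoch_tendsto[OF q, of s s] q r
    by (intro jacobi_triple_product[OF Q] eprod_pos) (auto simp: d)
  then show ?thesis
    by (simp add: theta_plus_exps_residue_class eprod_add q bounded_residue_class bounded_plus_comp
        bounded_minus_comp)
qed

text \<open>The product formula at \<open>a = - q^i\<close>, \<open>c = - q^j\<close>; the prefactor
  \<open>a\<close> gives the minus sign. The bound on \<open>j\<close> keeps the natural
  subtractions exact.\<close>

lemma theta_mult_power:
  assumes q: "0 < q" "q < 1" and s: "0 < s" "j \<le> s + i"
  shows "theta (- (q ^ i)) (q ^ s) * theta (- (q ^ j)) (q ^ s) =
    theta (q ^ (i + j)) (q ^ (2 * s)) * theta (q ^ (s + i - j)) (q ^ (2 * s)) -
    q ^ i * theta (q ^ (s + i + j)) (q ^ (2 * s)) * theta (q ^ (2 * s + i - j)) (q ^ (2 * s))"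
proof -
  have Q: "0 < q ^ s" "q ^ s < 1" using q s by (auto simp: power_less_one_iff)
  have "- (q ^ i) * - (q ^ j) = q ^ (i + j)"
    by (simp add: power_add)
  moreover have "- (q ^ i) * - (q ^ j) * q ^ s = q ^ (s + i + j)"
    by (simp add: power_add)
  moreover have "(q ^ s)\<^sup>2 = q ^ (2 * s)"
    by (simp add: power_mult[symmetric] mult.commute)
  moreover have "- (q ^ i) * q ^ t / - (q ^ j) = q ^ (t + i - j)" if "s \<le> t" for t
    using q s that power_diff[of q j "t + i"] by (simp add: power_add)
  from this[of s] this[of "2 * s"]
  have "- (q ^ i) * q ^ s / - (q ^ j) = q ^ (s + i - j)"
    "- (q ^ i) * q ^ (2 * s) / - (q ^ j) = q ^ (2 * s + i - j)"
    by simp_all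
  ultimately show ?thesis
    using theta_mult[OF Q, of "- (q ^ i)" "- (q ^ j)"] q by (simp del: minus_mult_minus mult_minus_left divide_minus_left divide_minus_right minus_divide_divide)
qed

subsection \<open>Generating functions of coloured partitions\<close>

definition restricted_partitions :: "(nat \<Rightarrow> nat) \<Rightarrow> (nat \<times> nat) set \<Rightarrow> nat \<Rightarrow> (nat \<times> nat) multiset set" where
  "restricted_partitions k S n = {M \<in> colored_partitions k n. set_mset M \<subseteq> S}"

lemma finite_restricted_partitions: "finite (restricted_partitions k S n)"
  using finite_colored_partitions[of k n] by (simp add: restricted_partitions_def)

text \<open>Either the part \<open>(m, c)\<close> is absent, or removing one copy leaves a partition
  of \<open>n - m\<close> over the same enlarged set.\<close>

lemma card_restricted_partitions_insert:
  assumes "(m, c) \<notin> S" "0 < m" "c < k m"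
  shows "card (restricted_partitions k (insert (m, c) S) n) = card (restricted_partitions k S n) +
    (if m \<le> n then card (restricted_partitions k (insert (m, c) S) (n - m)) else 0)"
proof -
  let ?T = "insert (m, c) S"
  let ?A = "if m \<le> n then add_mset (m, c) ` restricted_partitions k ?T (n - m) else {}"
  have "restricted_partitions k ?T n = restricted_partitions k S n \<union> ?A"
  proof (intro equalityI subsetI)
    fix M assume M: "M \<in> restricted_partitions k ?T n"
    show "M \<in> restricted_partitions k S n \<union> ?A"
    proof (cases "(m, c) \<in># M")
      case True
      then obtain N where "M = add_mset (m, c) N" by (meson multi_member_split)
      with M show ?thesis
        by (auto simp: restricted_partitions_def colored_partitions_def)
    next
      case False
      with M show ?thesis by (auto simp: restricted_partitions_def)
    qed
  next
    fix M assume "M \<in> restricted_partitions k S n \<union> ?A"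
    then show "M \<in> restricted_partitions k ?T n"
      using assms by (auto simp: restricted_partitions_def colored_partitions_def split: if_splits)
  qed
  moreover have "restricted_partitions k S n \<inter> ?A = {}"
    using assms by (auto simp: restricted_partitions_def)
  ultimately have "card (restricted_partitions k ?T n) = card (restricted_partitions k S n) + card ?A"
    using card_Un_disjoint[of "restricted_partitions k S n" ?A]
    by (simp add: finite_restricted_partitions split: if_splits)
  then show ?thesis by (auto simp: card_image inj_on_def)
qed

text \<open>The recurrence for a new part reads \<open>B = A + q^m * B\<close> for the generating
  functions, so each part contributes a factor \<open>1 / (1 - q^m)\<close>.\<close>

lemma sums_restricted_partitions:
  assumes q: "0 < q" "q < 1" and "finite S" and "\<And>m c. (m, c) \<in> S \<Longrightarrow> 0 < m \<and> c < k m"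
  shows "(\<lambda>n. real (card (restricted_partitions k S n)) * q ^ n) sums (1 / (\<Prod>(m, c)\<in>S. 1 - q ^ m))"
  using assms(3,4)
proof (induction S rule: finite_induct)
  case empty
  have "restricted_partitions k {} n = (if n = 0 then {{#}} else {})" for n
    by (auto simp: restricted_partitions_def colored_partitions_def)
  then have "(\<lambda>n. real (card (restricted_partitions k {} n)) * q ^ n) = (\<lambda>n. if n = 0 then 1 else 0)"
    by auto
  then show ?case using sums_single[of 0 "\<lambda>_. 1 :: real"] by simp
next
  case (insert s S)
  obtain m c where s: "s = (m, c)" by fastforce
  have mc: "0 < m" "c < k m" using insert.prems s by auto
  let ?a = "\<lambda>n. real (card (restricted_partitions k S n)) * q ^ n"
  let ?b = "\<lambda>n. real (card (restricted_partitions k (insert s S) n)) * q ^ n"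
  let ?c = "\<lambda>n. if m \<le> n then ?b (n - m) else 0"
  let ?A = "1 / (\<Prod>(m, c)\<in>S. 1 - q ^ m)"
  have a: "?a sums ?A" using insert by auto
  have x: "0 < q ^ m" "q ^ m < 1" using q mc by (auto simp: power_less_one_iff)
  have rec: "?b n = ?a n + q ^ m * ?c n" for n
  proof -
    have "q ^ n = q ^ m * q ^ (n - m)" if "m \<le> n" using that by (simp flip: power_add)
    then show ?thesis
      using card_restricted_partitions_insert[of m c S k n] insert.hyps mc
      by (auto simp: s distrib_right)
  qed
  \<comment> \<open>Convergence must precede solving for the sum: the recurrence bounds the partial
    sums, and the terms are nonnegative.\<close>
  have "(\<Sum>n<N. ?b n) \<le> ?A / (1 - q ^ m)" for N
  proof -
    have "(\<Sum>n<N. ?c n) = (\<Sum>n\<in>{m..<N}. ?b (n - m))"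
      by (rule sum.mono_neutral_cong_right) auto
    also have "\<dots> = (\<Sum>n<N - m. ?b n)"
      by (rule sum.reindex_bij_witness[of _ "\<lambda>i. i + m" "\<lambda>i. i - m"]) auto
    also have "\<dots> \<le> (\<Sum>n<N. ?b n)"
      using q by (intro sum_mono2) auto
    finally have "q ^ m * (\<Sum>n<N. ?c n) \<le> q ^ m * (\<Sum>n<N. ?b n)"
      using x by (intro mult_left_mono) auto
    moreover have "(\<Sum>n<N. ?a n) \<le> ?A"
      using a q sum_le_suminf[of ?a "{..<N}"] by (auto simp: sums_iff)
    moreover have "(\<Sum>n<N. ?b n) = (\<Sum>n<N. ?a n) + q ^ m * (\<Sum>n<N. ?c n)"
      by (subst rec) (simp only: sum.distrib sum_distrib_left)
    ultimately have "(\<Sum>n<N. ?b n) * (1 - q ^ m) \<le> ?A" by (simp add: algebra_simps)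
    moreover have "0 < 1 - q ^ m" using x by simp
    ultimately show ?thesis by (simp only: pos_le_divide_eq)
  qed
  then have "summable ?b"
    using q by (intro summableI_nonneg_bounded) auto
  then have b: "?b sums suminf ?b" by (rule summable_sums)
  then have "?c sums suminf ?b"
    using sums_zero_iff_shift[of m ?c "suminf ?b"] by simp
  from sums_add[OF a sums_mult[OF this, of "q ^ m"]]
  have "?b sums (?A + q ^ m * suminf ?b)" by (rule sums_cong[THEN iffD2, rotated]) (rule rec)
  then have "suminf ?b = ?A + q ^ m * suminf ?b" by (rule sums_unique2[OF b])
  moreover have "t = u / (1 - y)" if "t = u + y * t" "y < 1" for t u y :: real
    using that by (simp add: field_simps)
  ultimately have "suminf ?b = ?A / (1 - q ^ m)" using x(2) by blast
  moreover have "(\<Prod>(m, c)\<in>insert s S. 1 - q ^ m) = (\<Prod>(m, c)\<in>S. 1 - q ^ m) * (1 - q ^ m)"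
    using insert.hyps by (simp add: s)
  ultimately show ?case using b by (simp only: divide_divide_eq_left)
qed

text \<open>A squeeze by the partitions with parts at most \<open>N\<close>. Their generating
  functions \<open>e N\<close> tend to the product; they are at most the full series, while their
  low coefficients already agree with it.\<close>

theorem sums_num_colored_partitions:
  assumes q: "0 < q" "q < 1" and k: "bounded (range (\<lambda>m. real (k m)))"
  shows "(\<lambda>n. real (num_colored_partitions k n) * q ^ n) sums eprod q (\<lambda>m. - real (k m))"
proof -
  let ?E = "eprod q (\<lambda>m. - real (k m))"
  let ?p = "\<lambda>n. real (num_colored_partitions k n) * q ^ n"
  define S where "S N = (SIGMA m:{1..N}. {..<k m})" for N
  let ?r = "\<lambda>N n. real (card (restricted_partitions k (S N) n)) * q ^ n"
  define e where "e N = exp (\<Sum>m<N. - real (k (Suc m)) * ln (1 - q ^ Suc m))" for N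
  have bd: "bounded (range (\<lambda>m. - real (k m)))"
    using k by (simp add: bounded_iff)
  have x: "q ^ Suc m < 1" for m using q by (rule power_Suc_less_one)
  have r: "?r N sums e N" for N
  proof -
    have "(\<Prod>(m, c)\<in>S N. 1 - q ^ m) = (\<Prod>m\<in>{1..N}. (1 - q ^ m) ^ k m)"
      unfolding S_def by (subst prod.Sigma[symmetric]) auto
    also have "\<dots> = (\<Prod>m<N. (1 - q ^ Suc m) ^ k (Suc m))"
      by (rule prod.reindex_bij_witness[of _ Suc "\<lambda>m. m - 1"]) auto
    also have "\<dots> = (\<Prod>m<N. exp (real (k (Suc m)) * ln (1 - q ^ Suc m)))"
      using x by (intro prod.cong) (auto simp: exp_of_nat_mult)
    finally have "1 / (\<Prod>(m, c)\<in>S N. 1 - q ^ m) = e N"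
      by (simp add: e_def exp_sum exp_minus sum_negf prod_inversef inverse_eq_divide)
    then show ?thesis
      using sums_restricted_partitions[OF q, of "S N" k] by (auto simp: S_def)
  qed
  have e: "e \<longlonglongrightarrow> ?E" unfolding e_def by (rule eprod_tendsto[OF q bd])
  have e_le: "e N \<le> ?E" for N
  proof -
    have "0 \<le> - real (k (Suc m)) * ln (1 - q ^ Suc m)" for m
      using x[of m] q by (simp add: mult_nonneg_nonpos)
    then show ?thesis
      unfolding e_def eprod_def using eprod_summable[OF q bd]
      by (intro exp_le_cancel_iff[THEN iffD2] sum_le_suminf) auto
  qed
  have le: "?r N n \<le> ?p n" for N n
    using q card_mono[OF finite_colored_partitions, of "restricted_partitions k (S N) n" k n]
    by (auto simp: restricted_partitions_def num_colored_partitions_def intro!: mult_right_mono)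
  \<comment> \<open>No part of a partition of \<open>n\<close> exceeds \<open>n\<close>, so
    truncation at \<open>N\<close> leaves the coefficients up to \<open>N\<close> unchanged.\<close>
  have eq: "?r N n = ?p n" if "n \<le> N" for N n
  proof -
    have "set_mset M \<subseteq> S N" if M: "M \<in> colored_partitions k n" for M
    proof
      fix s assume s: "s \<in># M"
      obtain m c where mc: "s = (m, c)" by fastforce
      from s obtain M' where "M = add_mset s M'" by (meson multi_member_split)
      then have "m \<le> n" using M mc by (auto simp: colored_partitions_def)
      then show "s \<in> S N"
        using M s mc \<open>n \<le> N\<close> by (fastforce simp: S_def colored_partitions_def)
    qed
    then have "restricted_partitions k (S N) n = colored_partitions k n"
      by (auto simp: restricted_partitions_def)
    then show ?thesis by (simp add: num_colored_partitions_def)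
  qed
  have part: "(\<Sum>n<N. ?p n) \<le> ?E" for N
  proof -
    have "(\<Sum>n<N. ?p n) = (\<Sum>n<N. ?r N n)"
      by (intro sum.cong refl eq[symmetric]) auto
    also have "\<dots> \<le> e N"
      using r[of N] q sum_le_suminf[of "?r N" "{..<N}"] by (auto simp: sums_iff)
    finally show ?thesis using e_le[of N] by linarith
  qed
  then have p: "summable ?p" using q by (intro summableI_nonneg_bounded) auto
  have "suminf ?p \<le> ?E" using p part by (rule suminf_le_const)
  moreover have "e N \<le> suminf ?p" for N
    using sums_le[OF le[of N] r[of N] summable_sums[OF p]] by simp
  then have "?E \<le> suminf ?p" using e by (intro LIMSEQ_le_const2) auto
  ultimately show ?thesis using p by (simp add: sums_iff)
qed

lemma pm_colors_mod: "pm_colors s R D (m mod s) = pm_colors s R D m"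
  by (simp add: pm_colors_def in_pm_classes_def cong_def zmod_int)

lemma bounded_pm_colors: "bounded (range (\<lambda>m. real (pm_colors s R D m)))"
  by (rule boundedI[of _ 2]) (auto simp: pm_colors_def)

text \<open>Uniqueness of power series from values on \<open>(0, 1)\<close> alone: once the lower
  coefficients vanish, divide by \<open>x ^ n\<close> and let \<open>x\<close> tend to 0 from the
  right.\<close>

lemma coeff_eq_0_if_sums_0:
  fixes c :: "nat \<Rightarrow> real"
  assumes sums: "\<And>x. 0 < x \<Longrightarrow> x < 1 \<Longrightarrow> (\<lambda>n. c n * x ^ n) sums 0"
  shows "c n = 0"
proof (induction n rule: less_induct)
  case (less n)
  let ?d = "\<lambda>m. c (m + n)"
  have d: "(\<lambda>m. ?d m * x ^ m) sums 0" if x: "0 < x" "x < 1" for x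
  proof -
    have "(\<lambda>m. c (m + n) * x ^ (m + n)) sums 0"
      using sums[OF x] sums_zero_iff_shift[of n "\<lambda>m. c m * x ^ m" 0] less by simp
    from sums_divide[OF this, of "x ^ n"] show ?thesis
      using x by (simp add: power_add)
  qed
  let ?f = "\<lambda>x. \<Sum>m. ?d m * x ^ m"
  \<comment> \<open>The limit at 0 needs convergence for both signs of \<open>x\<close>; convergence
    at a positive \<open>y > |x|\<close> provides it.\<close>
  have "(\<lambda>m. ?d m * x ^ m) sums ?f x" if x: "norm x < 1" for x
  proof -
    obtain y where "\<bar>x\<bar> < y" "y < 1" using dense[of "\<bar>x\<bar>" 1] x by auto
    then show ?thesis
      using powser_inside[of ?d y x] d[of y] by (auto simp: sums_iff)
  qed
  then have "(?f \<longlongrightarrow> ?d 0) (at 0)" by (intro powser_limit_0[of 1]) auto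
  then have "(?f \<longlongrightarrow> ?d 0) (at_right 0)" by (rule filterlim_mono) (auto simp: at_le)
  moreover have "\<forall>\<^sub>F x in at_right 0. ?f x = 0"
    using d by (auto simp: sums_iff intro!: eventually_at_right_field[THEN iffD2] exI[of _ 1])
  ultimately have "((\<lambda>_. 0) \<longlongrightarrow> ?d 0) (at_right (0 :: real))"
    by (rule Lim_transform_eventually)
  then show "c n = 0" by (simp add: tendsto_const_iff)
qed

subsection \<open>The identity modulo 60\<close>

abbreviation "colors7 \<equiv>
  pm_colors 60 {2, 6, 7, 8, 9, 10, 12, 13, 17, 21, 22, 23, 24, 28} {10}"

abbreviation "colors8 \<equiv>
  pm_colors 60 {1, 3, 4, 10, 11, 12, 14, 16, 18, 19, 24, 26, 27, 29} {10}"

abbreviation "colors9 \<equiv>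
  pm_colors 60 {1, 4, 5, 6, 11, 12, 14, 16, 18, 19, 25, 26, 29} {12, 18}"

abbreviation "colors10 \<equiv>
  pm_colors 60 {2, 5, 6, 7, 8, 13, 17, 18, 22, 23, 24, 25, 28} {6, 24}"

text \<open>All moduli involved divide 60, so evaluation at 60 residues proves the three identities.
  The first two match the terms within each theta formula, the third matches the two left-hand
  sides.\<close>

lemma colors_theta_exps:
  "int (colors7 m) - int (colors10 m) =
    theta_plus_exps 30 24 m + theta_plus_exps 30 25 m -
    theta_plus_exps 30 9 m - theta_plus_exps 30 10 m \<and>
   int (colors9 m) - int (colors8 m) =
    theta_plus_exps 30 20 m + theta_plus_exps 30 27 m -
    theta_plus_exps 30 5 m - theta_plus_exps 30 12 m \<and>
   theta_minus_exps 15 2 m + theta_minus_exps 15 7 m -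
    (int (colors7 m) + theta_plus_exps 30 9 m + theta_plus_exps 30 10 m) =
   theta_minus_exps 15 1 m + theta_minus_exps 15 4 m -
    (int (colors9 m) + theta_plus_exps 30 5 m + theta_plus_exps 30 12 m)"
  (is "?P m")
proof -
  have "\<forall>m\<in>set [0..<60]. ?P m" by code_simp
  then have "?P (m mod 60)" by (rule bspec) simp
  then show "?P m" by (simp only: pm_colors_mod) (simp add: theta_exps_mod)
qed

lemma eprod_colors_identity:
  assumes q: "0 < q" "q < 1"
  shows "eprod q (\<lambda>m. - real (colors7 m)) + q * eprod q (\<lambda>m. - real (colors8 m)) =
    eprod q (\<lambda>m. - real (colors9 m)) + q\<^sup>2 * eprod q (\<lambda>m. - real (colors10 m))"
proof -
  define T where "T r m = real_of_int (theta_minus_exps 15 r m)" for r m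
  define U where "U r m = real_of_int (theta_plus_exps 30 r m)" for r m
  \<comment> \<open>Exponents of the multipliers: \<open>c\<close> turns \<open>U 9\<close>,
    \<open>U 10\<close> into the generating function of \<open>p7\<close>, and \<open>d\<close>
    turns \<open>U 5\<close>, \<open>U 12\<close> into that of \<open>p9\<close>.\<close>
  define c where "c m = - real (colors7 m) - (U 9 m + U 10 m)" for m
  define d where "d m = - real (colors9 m) - (U 5 m + U 12 m)" for m
  have bd: "bounded (range (T r))" "bounded (range (U r))" "bounded (range c)" "bounded (range d)" for r
  proof -
    show T: "bounded (range (T r))" for r
      unfolding T_def by (rule bounded_theta_exps)
    show U: "bounded (range (U r))" for r
      unfolding U_def by (rule bounded_theta_exps)
    have "bounded (range (\<lambda>m. - real (pm_colors s R D m)))" for s R D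
      using bounded_pm_colors[of s R D] by (simp add: bounded_iff)
    then show "bounded (range c)" "bounded (range d)"
      unfolding c_def d_def by (intro bounded_minus_comp bounded_plus_comp U; simp)+
  qed
  have add3: "eprod q k * (eprod q l * eprod q h) = eprod q e"
    if "bounded (range k)" "bounded (range l)" "bounded (range h)" "\<And>m. k m + (l m + h m) = e m" for k l h e
    using eprod_add[OF q that(1) bounded_plus_comp[OF that(2,3)]] eprod_add[OF q that(2,3)] that(4) by simp
  have T: "theta (- (q ^ r)) (q ^ 15) = eprod q (T r)" if "0 < r" "r < 15" for r
    using theta_uminus_power[OF q that] by (simp add: T_def[abs_def])
  have U: "theta (q ^ r) (q ^ 30) = eprod q (U r)" if "0 < r" "r < 30" for r
    using theta_power[OF q that] by (simp add: U_def[abs_def])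
  \<comment> \<open>Here \<open>s = 15\<close>, \<open>i = 2\<close>, \<open>j = 7\<close>; the
    companion formula has \<open>i = 1\<close>, \<open>j = 4\<close>.\<close>
  have 27: "eprod q (T 2) * eprod q (T 7) = eprod q (U 9) * eprod q (U 10) - q\<^sup>2 * (eprod q (U 24) * eprod q (U 25))"
    using theta_mult_power[OF q, of 15 7 2] by (simp add: T U)
  have 14: "eprod q (T 1) * eprod q (T 4) = eprod q (U 5) * eprod q (U 12) - q * (eprod q (U 20) * eprod q (U 27))"
    using theta_mult_power[OF q, of 15 4 1] T[of 1] by (simp add: T U)
  have exps:
    "real (colors7 m) - real (colors10 m) = U 24 m + U 25 m - U 9 m - U 10 m"
    "real (colors9 m) - real (colors8 m) = U 20 m + U 27 m - U 5 m - U 12 m"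
    "T 2 m + T 7 m - (real (colors7 m) + U 9 m + U 10 m) = T 1 m + T 4 m - (real (colors9 m) + U 5 m + U 12 m)" for m
    using colors_theta_exps[THEN conjunct1, of m, THEN arg_cong[where f = real_of_int]]
      colors_theta_exps[THEN conjunct2, THEN conjunct1, of m, THEN arg_cong[where f = real_of_int]]
      colors_theta_exps[THEN conjunct2, THEN conjunct2, of m, THEN arg_cong[where f = real_of_int]]
    by (simp_all add: T_def U_def)
  have "eprod q (\<lambda>m. - real (colors7 m)) - q\<^sup>2 * eprod q (\<lambda>m. - real (colors10 m)) =
      eprod q c * (eprod q (U 9) * eprod q (U 10)) - q\<^sup>2 * (eprod q c * (eprod q (U 24) * eprod q (U 25)))"
    using add3[OF bd(3,2,2), of 9 10 "\<lambda>m. - real (colors7 m)"]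
      add3[OF bd(3,2,2), of 24 25 "\<lambda>m. - real (colors10 m)"] exps(1) by (simp add: c_def algebra_simps)
  also have "\<dots> = eprod q c * (eprod q (T 2) * eprod q (T 7))"
    unfolding 27 by (simp add: algebra_simps)
  also have "\<dots> = eprod q d * (eprod q (T 1) * eprod q (T 4))"
    using add3[OF bd(3,1,1), of 2 7 "\<lambda>m. d m + (T 1 m + T 4 m)"]
      add3[OF bd(4,1,1), of 1 4 "\<lambda>m. d m + (T 1 m + T 4 m)"] exps(3)
    by (simp add: c_def d_def algebra_simps)
  also have "\<dots> = eprod q d * (eprod q (U 5) * eprod q (U 12)) - q * (eprod q d * (eprod q (U 20) * eprod q (U 27)))"
    unfolding 14 by (simp add: algebra_simps)
  also have "\<dots> = eprod q (\<lambda>m. - real (colors9 m)) - q * eprod q (\<lambda>m. - real (colors8 m))"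
    using add3[OF bd(4,2,2), of 5 12 "\<lambda>m. - real (colors9 m)"]
      add3[OF bd(4,2,2), of 20 27 "\<lambda>m. - real (colors8 m)"] exps(2) by (simp add: d_def algebra_simps)
  finally show ?thesis by simp
qed

theorem theorem7p3:
  fixes n :: nat
  assumes "n > 1"
  shows "p7 n + p8 (n - 1) = p9 n + p10 (n - 2)"
proof -
  \<comment> \<open>Coefficients of \<open>q^j\<close> times a generating function. They vanish
    below \<open>j\<close>, where truncated subtraction would give \<open>p 0\<close> instead; thus
    \<open>b\<close> vanishes for every \<open>n\<close>, and \<open>n > 1\<close> is used only to
    unfold \<open>shift\<close>.\<close>
  define shift where "shift j p n = (if j \<le> n then real (p (n - j)) else 0)"
    for j n :: nat and p :: "nat \<Rightarrow> nat"
  define b where "b n = (real (p7 n) + shift 1 p8 n) - (real (p9 n) + shift 2 p10 n)" for n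
  have "b n = 0" for n
  proof (rule coeff_eq_0_if_sums_0)
    fix q :: real assume q: "0 < q" "q < 1"
    let ?F = "\<lambda>k. eprod q (\<lambda>m. - real (k m))"
    note gf = sums_num_colored_partitions[OF q bounded_pm_colors]
    have shifted: "(\<lambda>n. shift j p n * q ^ n) sums (q ^ j * s)"
      if "(\<lambda>n. real (p n) * q ^ n) sums s" for j p s
    proof -
      have "(\<lambda>n. shift j p (n + j) * q ^ (n + j)) sums (q ^ j * s)"
        using sums_mult[OF that, of "q ^ j"] by (simp add: shift_def power_add mult_ac)
      then show ?thesis
        using sums_zero_iff_shift[of j "\<lambda>n. shift j p n * q ^ n"] by (simp add: shift_def)
    qed
    have "(\<lambda>n. real (p7 n) * q ^ n) sums ?F colors7"
      "(\<lambda>n. shift 1 p8 n * q ^ n) sums (q ^ 1 * ?F colors8)"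
      "(\<lambda>n. real (p9 n) * q ^ n) sums ?F colors9"
      "(\<lambda>n. shift 2 p10 n * q ^ n) sums (q ^ 2 * ?F colors10)"
      unfolding p7_def p8_def p9_def p10_def by (intro shifted gf)+
    then have "(\<lambda>n. (real (p7 n) * q ^ n + shift 1 p8 n * q ^ n) - (real (p9 n) * q ^ n + shift 2 p10 n * q ^ n))
        sums ((?F colors7 + q ^ 1 * ?F colors8) - (?F colors9 + q ^ 2 * ?F colors10))"
      by (intro sums_diff sums_add)
    then show "(\<lambda>n. b n * q ^ n) sums 0"
      using eprod_colors_identity[OF q] by (simp add: b_def algebra_simps)
  qed
  from this[of n] show ?thesis using assms by (simp add: b_def shift_def)
qed

end
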